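(* Let $n\ge 1$ and suppose that the operator $\bar\Phi^{\bar\varepsilon}:\bar\Lambda^n\to\mathbb{R}_+^{n\times|\mathcal{P}|}$, $$\bar\Phi_p^{\bar\varepsilon}(k,\bar h)=\max\left\{\bar\Psi_p(k,\bar h),\ v_{ij}(\bar h)+\bar\varepsilon_{ij}^p(\bar h)\right\}-\left(\bar\varepsilon_{ij}^p(\bar h)-\min_{q\in\mathcal{P}_{ij}}\bar\varepsilon_{ij}^q(\bar h)\right),\qquad 1\le k\le n,\ p\in\mathcal{P}_{ij},$$ is continuous. Then the set of all solutions of the discrete-time VT-BR-DUE problem is a closed and bounded, and thus compact, set in $\bar\Lambda^n\subset\mathbb{R}^{n\times|\mathcal{P}|}$.
   Context: $\mathcal{W}$ is a finite set of origin-destination (O-D) pairs; $\mathcal{P}$ is the finite set of paths, the disjoint union of the nonempty sets $\mathcal{P}_{ij}$, $(i,j)\in\mathcal{W}$; $Q_{ij}>0$ are given demands. $\mathbb{R}_+$ (resp. $\mathbb{R}_{++}$) denotes the nonnegative (resp. positive) reals. The feasible set is $$\Lambda=\Big\{h\in\big(L_+^2[t_0,t_f]\big)^{|\mathcal{P}|}:\ \sum_{p\in\mathcal{P}_{ij}}\int_{t_0}^{t_f}h_p(t)\,dt=Q_{ij}\ \ \forall (i,j)\in\mathcal{W}\Big\},$$ where $L^2_+$ denotes nonnegative $L^2$ functions. The effective path delay operator $\Psi:\Lambda\to(L_+^2[t_0,t_f])^{|\mathcal{P}|}$ gives the travel costs $\Psi_p(\cdot,h)$ (measurable, positive a.e.,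 square integrable), and $\varepsilon_{ij}^p(\cdot):\Lambda\to\mathbb{R}_{++}$ are tolerance functionals. Discretization: $[t_0,t_f]$ is partitioned uniformly into $n$ subintervals $I_1,\dots,I_n$ of length $\delta t=(t_f-t_0)/n$. $\Lambda^n$ is the set of $h\in\Lambda$ with every $h_p$ constant on every $I_k$. To $h\in\Lambda^n$ corresponds $\bar h=(\bar h_p(k))\in\mathbb{R}_+^{n\times|\mathcal{P}|}$ with $\bar h_p(k)=h_p(t)$, $t\in I_k$; the set of such vectors is $$\bar\Lambda^n=\Big\{\bar h\in\mathbb{R}_+^{n\times|\mathcal{P}|}:\ \delta t\sum_{p\in\mathcal{P}_{ij}}\sum_{k=1}^n\bar h_p(k)=Q_{ij}\ \ \forall(i,j)\in\mathcal{W}\Big\}.$$ For $\bar h\in\bar\Lambda^n$ with counterpart $h\in\Lambda^n$: $\bar\Psi_p(k,\bar h)=\frac{1}{|I_k|}\int_{I_k}\Psi_p(t,h)\,dt$, $\bar\varepsilon_{ij}^p(\bar h)=\varepsilon_{ij}^p(h)$, and $v_{ij}(\bar h)=\min_{1\le k\le n,\,p\in\mathcal{P}_{ij}}\bar\Psi_p(k,\bar h)$. Definition. $\bar h^*\in\bar\Lambda^n$ is a solution of the discrete-time VT-BR-DUE problem if for all $(i,j)\in\mathcal{W}$, $p\in\mathcal{P}_{ij}$, $1\le k\le n$: $\bar h_p^*(k)>0\Rightarrow\bar\Psi_p(k,\bar h^* )\in[v_{ij}(\bar h^* ),\,v_{ij}(\bar h^* )+\bar\varepsilon_{ij}^p(\bar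 h^* )]$. *)

theory Defs
  imports "HOL-Analysis.Analysis"
begin

text \<open>
  Flows (and delays) \<open>h = (h\<^sub>p)\<close> are represented by functions \<open>h p t\<close>; only the values on
  \<open>{t0..tf}\<close> matter, and elements of \<open>L\<^sup>2\<close> are such functions up to \<open>flow_eq\<close>.
\<close>

type_synonym 'p flow = "'p \<Rightarrow> real \<Rightarrow> real"

definition L2_nonneg :: "real \<Rightarrow> real \<Rightarrow> (real \<Rightarrow> real) set" where
  "L2_nonneg t0 tf = {f \<in> borel_measurable (lebesgue_on {t0..tf}).
     integrable (lebesgue_on {t0..tf}) (\<lambda>t. (f t)\<^sup>2) \<and>
     (AE t in lebesgue_on {t0..tf}. 0 \<le> f t)}"

definition flow_eq :: "real \<Rightarrow> real \<Rightarrow> 'p flow \<Rightarrow> 'p flow \<Rightarrow> bool" where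
  "flow_eq t0 tf g h \<longleftrightarrow> (\<forall>p. AE t in lebesgue_on {t0..tf}. g p t = h p t)"

definition feasible_flows ::
  "real \<Rightarrow> real \<Rightarrow> 'w set \<Rightarrow> ('w \<Rightarrow> 'p set) \<Rightarrow> ('w \<Rightarrow> real) \<Rightarrow> 'p flow set" where
  "feasible_flows t0 tf W P Q = {h. (\<forall>p. h p \<in> L2_nonneg t0 tf) \<and>
     (\<forall>w\<in>W. (\<Sum>p\<in>P w. \<integral>t. h p t \<partial>lebesgue_on {t0..tf}) = Q w)}"

text \<open>
  The \<open>n\<close> time steps are the elements of a finite linearly ordered type \<open>'n\<close>, so \<open>n = CARD('n)\<close>
  and a discretized flow is a matrix \<open>h :: real ^ 'p ^ 'n\<close> with entries \<open>h $ k $ p\<close>.  The zero-based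
  position of \<open>k\<close> is \<open>step_index k\<close>.  The subintervals are half-open, the last one being closed, so
  that they partition \<open>{t0..tf}\<close>.
\<close>

definition step_index :: "'n::{finite,linorder} \<Rightarrow> nat" where
  "step_index k = card {..<k}"

definition subinterval :: "real \<Rightarrow> real \<Rightarrow> 'n::{finite,linorder} \<Rightarrow> real set" where
  "subinterval t0 tf (k::'n) =
    (let dt = (tf - t0) / real CARD('n);
         a = t0 + real (step_index k) * dt;
         b = t0 + real (step_index k + 1) * dt
     in if step_index k + 1 = CARD('n) then {a..b} else {a..<b})"

definition pc_flows ::
  "'n::{finite,linorder} itself \<Rightarrow> real \<Rightarrow> real \<Rightarrow> 'w set \<Rightarrow> ('w \<Rightarrow> 'p set) \<Rightarrow> ('w \<Rightarrow> real) \<Rightarrow> 'p flow set"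
  where
  "pc_flows _ t0 tf W P Q = {h \<in> feasible_flows t0 tf W P Q.
     \<forall>p. \<forall>k::'n. (h p) constant_on (subinterval t0 tf k)}"

definition discrete_flows ::
  "real \<Rightarrow> real \<Rightarrow> 'w set \<Rightarrow> ('w \<Rightarrow> 'p set) \<Rightarrow> ('w \<Rightarrow> real)
    \<Rightarrow> (real ^ 'p::finite ^ 'n::{finite,linorder}) set" where
  "discrete_flows t0 tf W P Q = {h. (\<forall>k p. 0 \<le> h $ k $ p) \<and>
     (\<forall>w\<in>W. (tf - t0) / real CARD('n) * (\<Sum>p\<in>P w. \<Sum>k\<in>UNIV. h $ k $ p) = Q w)}"

definition step_flow :: "real \<Rightarrow> real \<Rightarrow> real ^ 'p::finite ^ 'n::{finite,linorder} \<Rightarrow> 'p flow" where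
  "step_flow t0 tf h = (\<lambda>p t. \<Sum>k\<in>UNIV. h $ k $ p * indicator (subinterval t0 tf k) t)"

definition delay_avg ::
  "real \<Rightarrow> real \<Rightarrow> ('p::finite flow \<Rightarrow> 'p flow)
    \<Rightarrow> 'n::{finite,linorder} \<Rightarrow> 'p \<Rightarrow> real ^ 'p ^ 'n::_ \<Rightarrow> real" where
  "delay_avg t0 tf Psi k p h =
     (\<integral>t. Psi (step_flow t0 tf h) p t \<partial>lebesgue_on (subinterval t0 tf k))
       / measure lebesgue (subinterval t0 tf k)"

definition tolerance ::
  "real \<Rightarrow> real \<Rightarrow> ('w \<Rightarrow> 'p \<Rightarrow> 'p flow \<Rightarrow> real) \<Rightarrow> 'w \<Rightarrow> 'p
    \<Rightarrow> real ^ 'p::finite ^ 'n::{finite,linorder} \<Rightarrow> real" where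
  "tolerance t0 tf eps w p h = eps w p (step_flow t0 tf h)"

definition min_delay ::
  "real \<Rightarrow> real \<Rightarrow> ('w \<Rightarrow> 'p set) \<Rightarrow> ('p flow \<Rightarrow> 'p flow) \<Rightarrow> 'w
    \<Rightarrow> real ^ 'p::finite ^ 'n::{finite,linorder} \<Rightarrow> real" where
  "min_delay t0 tf P Psi w h =
     Min ((\<lambda>(k, p). delay_avg t0 tf Psi k p h) ` (UNIV \<times> P w))"

definition od_pair :: "'w set \<Rightarrow> ('w \<Rightarrow> 'p set) \<Rightarrow> 'p \<Rightarrow> 'w" where
  "od_pair W P p = (THE w. w \<in> W \<and> p \<in> P w)"

definition Phi_bar ::
  "real \<Rightarrow> real \<Rightarrow> 'w set \<Rightarrow> ('w \<Rightarrow> 'p set) \<Rightarrow> ('p flow \<Rightarrow> 'p flow) \<Rightarrow> ('w \<Rightarrow> 'p \<Rightarrow> 'p flow \<Rightarrow> real)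
    \<Rightarrow> real ^ 'p::finite ^ 'n::{finite,linorder} \<Rightarrow> real ^ 'p ^ 'n::_" where
  "Phi_bar t0 tf W P Psi eps h = (\<chi> k p. let w = od_pair W P p in
     max (delay_avg t0 tf Psi k p h) (min_delay t0 tf P Psi w h + tolerance t0 tf eps w p h)
     - (tolerance t0 tf eps w p h - Min ((\<lambda>q. tolerance t0 tf eps w q h) ` P w)))"

definition discrete_vt_br_due ::
  "real \<Rightarrow> real \<Rightarrow> 'w set \<Rightarrow> ('w \<Rightarrow> 'p set) \<Rightarrow> ('w \<Rightarrow> real)
    \<Rightarrow> ('p flow \<Rightarrow> 'p flow) \<Rightarrow> ('w \<Rightarrow> 'p \<Rightarrow> 'p flow \<Rightarrow> real)
    \<Rightarrow> (real ^ 'p::finite ^ 'n::{finite,linorder}) set" where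
  "discrete_vt_br_due t0 tf W P Q Psi eps = {h \<in> discrete_flows t0 tf W P Q.
     \<forall>w\<in>W. \<forall>p\<in>P w. \<forall>k. 0 < h $ k $ p \<longrightarrow>
       delay_avg t0 tf Psi k p h \<in>
         {min_delay t0 tf P Psi w h .. min_delay t0 tf P Psi w h + tolerance t0 tf eps w p h}}"

lemma step_index_less: "step_index (k::'n::{finite,linorder}) < CARD('n)"
  unfolding step_index_def by (rule psubset_card_mono) auto

lemma step_index_mono: "k < l \<Longrightarrow> step_index (k::'n::{finite,linorder}) < step_index l"
  unfolding step_index_def by (rule psubset_card_mono) auto

lemma step_index_inj: "inj (step_index :: 'n::{finite,linorder} \<Rightarrow> nat)"
  by (rule injI) (metis less_irrefl linorder_neqE step_index_mono)

lemma step_index_range: "range (step_index :: 'n::{finite,linorder} \<Rightarrow> nat) = {..<CARD('n)}"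
  by (rule card_subset_eq) (auto simp: step_index_less card_image step_index_inj)

lemma subinterval_measure:
  assumes "t0 < tf"
  shows "subinterval t0 tf (k::'n::{finite,linorder}) \<in> sets lebesgue"
    and "measure lebesgue (subinterval t0 tf k) = (tf - t0) / real CARD('n)"
proof -
  have "0 \<le> (tf - t0) / real CARD('n)" using assms by simp
  then show "measure lebesgue (subinterval t0 tf k) = (tf - t0) / real CARD('n)"
    by (auto simp: subinterval_def Let_def algebra_simps)
  show "subinterval t0 tf k \<in> sets lebesgue"
    by (auto simp: subinterval_def Let_def)
qed

lemma subinterval_cover:
  assumes "t0 < tf"
  shows "(\<Union>k::'n::{finite,linorder}. subinterval t0 tf k) = {t0..tf}"
proof (intro equalityI subsetI)
  define dt where "dt = (tf - t0) / real CARD('n)"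
  have dt: "dt > 0" and n: "t0 + real CARD('n) * dt = tf" using assms by (auto simp: dt_def)
  {
    fix t assume "t \<in> (\<Union>k::'n. subinterval t0 tf k)"
    then obtain k :: 'n where t: "t \<in> subinterval t0 tf k" by auto
    have "t0 + real (step_index k) * dt \<le> t" "t \<le> t0 + real (step_index k + 1) * dt"
      using t by (auto simp: subinterval_def Let_def dt_def split: if_splits)
    moreover have "real (step_index k + 1) * dt \<le> real CARD('n) * dt"
      using step_index_less[of k] dt by (intro mult_right_mono) auto
    moreover have "0 \<le> real (step_index k) * dt" using dt by simp
    ultimately show "t \<in> {t0..tf}" using n by auto
  next
    fix t assume t: "t \<in> {t0..tf}"
    define m where "m = min (nat \<lfloor>(t - t0) / dt\<rfloor>) (CARD('n) - 1)"
    have "m < CARD('n)" using zero_less_card_finite[where 'a='n] by (simp add: m_def min_less_iff_disj)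
    then obtain k :: 'n where k: "step_index k = m"
      using step_index_range[where 'n='n] by (metis imageE lessThan_iff)
    have q: "0 \<le> (t - t0) / dt" using t dt by auto
    have "real m \<le> (t - t0) / dt" using q by (simp add: m_def min_def) linarith
    then have a: "t0 + real m * dt \<le> t" using dt by (simp add: field_simps)
    show "t \<in> (\<Union>k::'n. subinterval t0 tf k)"
    proof (cases "m + 1 = CARD('n)")
      case True
      then have "t \<le> t0 + real (m + 1) * dt" using t n by simp
      then show ?thesis using a True k t
        by (intro UN_I[of k]) (auto simp: subinterval_def Let_def dt_def)
    next
      case False
      then have "m = nat \<lfloor>(t - t0) / dt\<rfloor>" using \<open>m < CARD('n)\<close> by (auto simp: m_def min_def split: if_splits)
      then have "(t - t0) / dt < real (m + 1)" using q by linarith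
      then have "t < t0 + real (m + 1) * dt" using dt by (simp add: field_simps)
      then show ?thesis using a False k
        by (intro UN_I[of k]) (auto simp: subinterval_def Let_def dt_def)
    qed
  }
qed

lemma subinterval_lebesgue_on:
  fixes k :: "'n::{finite,linorder}"
  assumes "t0 < tf"
  shows "subinterval t0 tf k \<in> sets (lebesgue_on {t0..tf})" (is ?meas)
    and "measure (lebesgue_on {t0..tf}) (subinterval t0 tf k) = (tf - t0) / real CARD('n)"
    and "integrable (lebesgue_on {t0..tf}) (indicator (subinterval t0 tf k) :: real \<Rightarrow> real)"
proof -
  have sub: "subinterval t0 tf k \<subseteq> {t0..tf}"
    using subinterval_cover[OF assms, where 'n='n] by auto
  show meas: ?meas
    using subinterval_measure(1)[OF assms] sub by (simp add: sets_restrict_space_iff)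
  show "measure (lebesgue_on {t0..tf}) (subinterval t0 tf k) = (tf - t0) / real CARD('n)"
    using sub subinterval_measure(2)[OF assms] by (simp add: measure_restrict_space)
  have "emeasure (lebesgue_on {t0..tf}) (subinterval t0 tf k) \<le> emeasure lebesgue {t0..tf}"
    using sub by (simp add: emeasure_restrict_space emeasure_mono
        del: emeasure_completion emeasure_lborel_Icc_eq)
  also have "\<dots> < \<infinity>" using assms by simp
  finally show "integrable (lebesgue_on {t0..tf}) (indicator (subinterval t0 tf k) :: real \<Rightarrow> real)"
    using meas by simp
qed

lemma subinterval_disjoint:
  assumes "t0 < tf" and "t \<in> subinterval t0 tf k" "t \<in> subinterval t0 tf l"
  shows "k = (l::'n::{finite,linorder})"
proof -
  have *: False if "k < l" "t \<in> subinterval t0 tf k" "t \<in> subinterval t0 tf l" for k l :: 'n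
  proof -
    have "step_index k + 1 \<le> step_index l" using step_index_mono[OF that(1)] by simp
    then have "real (step_index k + 1) * ((tf - t0) / real CARD('n))
        \<le> real (step_index l) * ((tf - t0) / real CARD('n))"
      using assms(1) by (intro mult_right_mono) auto
    moreover have "step_index k + 1 \<noteq> CARD('n)"
      using step_index_mono[OF that(1)] step_index_less[of l] by simp
    ultimately show False using that(2,3)
      by (auto simp: subinterval_def Let_def split: if_splits)
  qed
  then show ?thesis using assms(2,3) by (metis linorder_neqE)
qed

lemma step_flow_eq:
  assumes "t0 < tf" "t \<in> subinterval t0 tf k"
  shows "step_flow t0 tf h p t = h $ k $ p"
proof -
  have "h $ l $ p * indicator (subinterval t0 tf l) t = (if l = k then h $ k $ p else 0)" for l
    using subinterval_disjoint[OF assms(1)] assms(2) by (auto simp: indicator_def)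
  then show ?thesis unfolding step_flow_def by (simp only: sum.delta finite UNIV_I if_True)
qed

text \<open>
  \<open>step_flow\<close> is a bijection between discretized and piecewise constant flows, up to values
  outside \<open>{t0..tf}\<close>.
\<close>

lemma step_flow_pc:
  fixes h :: "real ^ 'p::finite ^ 'n::{finite,linorder}"
  assumes "t0 < tf" and h: "h \<in> discrete_flows t0 tf W P Q"
  shows "step_flow t0 tf h \<in> pc_flows TYPE('n) t0 tf W P Q"
proof -
  let ?M = "lebesgue_on {t0..tf}"
  have sub: "subinterval t0 tf k \<subseteq> {t0..tf}" for k :: 'n
    using subinterval_cover[OF assms(1), where 'n='n] by auto
  note meas = subinterval_lebesgue_on(1)[OF assms(1), where 'n='n]
    and mu = subinterval_lebesgue_on(2)[OF assms(1), where 'n='n]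
    and ind = subinterval_lebesgue_on(3)[OF assms(1), where 'n='n]
  have pos: "0 \<le> step_flow t0 tf h p t" for p t
    using h by (auto simp: step_flow_def discrete_flows_def intro!: sum_nonneg)
  have int: "(\<integral>t. step_flow t0 tf h p t \<partial>?M) = (\<Sum>k\<in>UNIV. h $ k $ p * ((tf - t0) / real CARD('n)))" for p
    unfolding step_flow_def using ind meas mu sub
    by (subst Bochner_Integration.integral_sum) (auto simp: Int_absorb2)
  have sq: "(step_flow t0 tf h p t)\<^sup>2
      = (\<Sum>k\<in>UNIV. (h $ k $ p)\<^sup>2 * indicator (subinterval t0 tf k) t)" if t: "t \<in> {t0..tf}" for p t
  proof -
    obtain k :: 'n where k: "t \<in> subinterval t0 tf k"
      using t subinterval_cover[OF assms(1), where 'n='n] by (metis UN_iff)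
    have "(h $ l $ p)\<^sup>2 * indicator (subinterval t0 tf l) t = (if l = k then (h $ k $ p)\<^sup>2 else 0)" for l
      using subinterval_disjoint[OF assms(1)] k by (auto simp: indicator_def)
    then show ?thesis unfolding step_flow_eq[OF assms(1) k]
      by (simp only: sum.delta finite UNIV_I if_True)
  qed
  have "integrable ?M (\<lambda>t. (step_flow t0 tf h p t)\<^sup>2)" for p
    by (subst Bochner_Integration.integrable_cong[OF refl sq]) (simp, intro Bochner_Integration.integrable_sum integrable_mult_right ind)
  moreover have "step_flow t0 tf h p \<in> borel_measurable ?M" for p
    unfolding step_flow_def
    by (intro borel_measurable_integrable Bochner_Integration.integrable_sum integrable_mult_right ind)
  moreover have "(\<Sum>p\<in>P w. \<integral>t. step_flow t0 tf h p t \<partial>?M) = Q w" if "w \<in> W" for w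
    using h that unfolding int by (simp add: discrete_flows_def sum_distrib_left sum_distrib_right mult_ac)
  moreover have "(step_flow t0 tf h p) constant_on (subinterval t0 tf k)" for p and k :: 'n
    unfolding constant_on_def by (rule exI[of _ "h $ k $ p"]) (simp add: step_flow_eq[OF assms(1)])
  ultimately show ?thesis
    using pos by (simp add: pc_flows_def feasible_flows_def L2_nonneg_def)
qed

lemma pc_flow_step:
  fixes g :: "'p::finite flow"
  assumes "t0 < tf" and g: "g \<in> pc_flows TYPE('n::{finite,linorder}) t0 tf W P Q"
  shows "\<exists>!h::real ^ 'p ^ 'n::_. h \<in> discrete_flows t0 tf W P Q \<and>
    (\<forall>p. \<forall>t\<in>{t0..tf}. g p t = step_flow t0 tf h p t)"
proof -
  let ?M = "lebesgue_on {t0..tf}"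
  have cover: "(\<Union>k::'n. subinterval t0 tf k) = {t0..tf}"
    using subinterval_cover[OF assms(1)] .
  have sub: "subinterval t0 tf k \<subseteq> {t0..tf}" for k :: 'n using cover by auto
  have len: "0 < (tf - t0) / real CARD('n)" using assms(1) by simp
  have ne: "subinterval t0 tf k \<noteq> {}" for k :: 'n
    using subinterval_measure(2)[OF assms(1), of k] len by auto
  define h :: "real ^ 'p ^ 'n::_" where "h = (\<chi> k p. g p (SOME t. t \<in> subinterval t0 tf k))"
  have val: "g p t = h $ k $ p" if "t \<in> subinterval t0 tf k" for p t k
  proof -
    have "(g p) constant_on (subinterval t0 tf k)" using g by (simp add: pc_flows_def)
    moreover have "(SOME t. t \<in> subinterval t0 tf k) \<in> subinterval t0 tf k"
      using ne by (simp add: some_in_eq)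
    ultimately show ?thesis using that by (auto simp: h_def constant_on_def)
  qed
  have eq: "g p t = step_flow t0 tf h p t" if "t \<in> {t0..tf}" for p t
    using that val step_flow_eq[OF assms(1)] cover by (metis (no_types, lifting) UN_iff)
  note meas = subinterval_lebesgue_on(1)[OF assms(1), where 'n='n]
    and mu = subinterval_lebesgue_on(2)[OF assms(1), where 'n='n]
    and ind = subinterval_lebesgue_on(3)[OF assms(1), where 'n='n]
  have nonneg: "0 \<le> h $ k $ p" for k p
  proof (rule ccontr)
    assume neg: "\<not> 0 \<le> h $ k $ p"
    have "AE t in ?M. 0 \<le> g p t" 
      using g by (auto simp: pc_flows_def feasible_flows_def L2_nonneg_def)
    then have "AE t in ?M. t \<notin> subinterval t0 tf k"
      by eventually_elim (use neg val in auto)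
    then have "measure ?M (subinterval t0 tf k) = 0"
      using meas by (subst (asm) AE_iff_measurable[where N="subinterval t0 tf k"])
        (use sub[THEN subsetD] in \<open>auto simp: measure_def\<close>)
    then show False using mu len by simp
  qed
  have int: "(\<integral>t. g p t \<partial>?M) = (\<Sum>k\<in>UNIV. h $ k $ p * ((tf - t0) / real CARD('n)))" for p
  proof -
    have "(\<integral>t. g p t \<partial>?M) = (\<integral>t. step_flow t0 tf h p t \<partial>?M)"
      using eq by (intro Bochner_Integration.integral_cong) auto
    also have "\<dots> = (\<Sum>k\<in>UNIV. h $ k $ p * ((tf - t0) / real CARD('n)))"
      unfolding step_flow_def using ind meas mu sub
      by (subst Bochner_Integration.integral_sum) (auto simp: Int_absorb2)
    finally show ?thesis .
  qed
  have "(tf - t0) / real CARD('n) * (\<Sum>p\<in>P w. \<Sum>k\<in>UNIV. h $ k $ p) = Q w" if "w \<in> W" for w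
  proof -
    have "(\<Sum>p\<in>P w. \<integral>t. g p t \<partial>?M) = Q w"
      using g that by (simp add: pc_flows_def feasible_flows_def)
    then show ?thesis unfolding int by (simp add: sum_distrib_left sum_distrib_right mult_ac)
  qed
  then have "h \<in> discrete_flows t0 tf W P Q" using nonneg by (simp add: discrete_flows_def)
  moreover have "h' = h" if "\<forall>p. \<forall>t\<in>{t0..tf}. g p t = step_flow t0 tf h' p t" for h' :: "real ^ 'p ^ 'n::_"
  proof -
    have "h' $ k $ p = h $ k $ p" for k p
    proof -
      obtain t where t: "t \<in> subinterval t0 tf k" using ne by blast
      have "g p t = step_flow t0 tf h' p t" using that t sub by blast
      then show ?thesis
        using step_flow_eq[OF assms(1) t, of h' p] val[OF t] by simp
    qed
    then show ?thesis by (simp add: vec_eq_iff)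
  qed
  ultimately show ?thesis using eq by (intro ex1I[of _ h]) auto
qed

end

theory Submission
  imports Defs
begin

text \<open>
  For each O-D pair \<open>w\<close>, the entries of \<open>Phi_bar h\<close> over \<open>P w\<close> are bounded below by
  \<open>v\<^sub>w + min eps\<close>, this bound is attained at the minimizers of the averaged delay, and an entry
  equals it precisely when its delay exceeds \<open>v\<^sub>w\<close> by at most its own tolerance.  Hence the
  equilibria are the solutions of a complementarity condition on \<open>Phi_bar\<close>, expressible by
  finitely many weak inequalities \<open>h\<^sub>p(k) * (Phi\<^sub>p(k) - Phi\<^sub>q(l)) \<le> 0\<close>, which are closed
  conditions as \<open>Phi_bar\<close> is continuous.  The set of discretized flows is itself compact, since the
  demands bound the sum of all entries.
\<close>

lemma closed_discrete_flows:
  "closed (discrete_flows t0 tf W P Q :: (real ^ 'p::finite ^ 'n::{finite,linorder}) set)"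
proof -
  have "discrete_flows t0 tf W P Q =
      (\<Inter>k. \<Inter>p. {h :: real ^ 'p ^ 'n::_. 0 \<le> h $ k $ p}) \<inter>
      (\<Inter>w\<in>W. {h. (tf - t0) / real CARD('n) * (\<Sum>p\<in>P w. \<Sum>k\<in>UNIV. h $ k $ p) = Q w})"
    by (auto simp: discrete_flows_def)
  also have "closed \<dots>"
    by (intro closed_Int closed_INT ballI closed_Collect_le closed_Collect_eq continuous_intros)
  finally show ?thesis .
qed

lemma bounded_discrete_flows:
  fixes P :: "'w \<Rightarrow> 'p::finite set"
  assumes "t0 < tf" "finite W" "disjoint_family_on P W" "(\<Union>w\<in>W. P w) = UNIV"
  shows "bounded (discrete_flows t0 tf W P Q :: (real ^ 'p ^ 'n::{finite,linorder}) set)"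
proof (rule boundedI)
  fix h :: "real ^ 'p ^ 'n::_"
  assume h: "h \<in> discrete_flows t0 tf W P Q"
  have "norm h \<le> (\<Sum>k\<in>UNIV. norm (h $ k))"
    unfolding norm_vec_def by (rule L2_set_le_sum) simp
  also have "\<dots> \<le> (\<Sum>k\<in>UNIV. \<Sum>p\<in>UNIV. h $ k $ p)"
  proof (rule sum_mono)
    fix k
    show "norm (h $ k) \<le> (\<Sum>p\<in>UNIV. h $ k $ p)"
      using norm_le_l1_cart[of "h $ k"] h by (simp add: discrete_flows_def)
  qed
  \<comment> \<open>The sets \<open>P w\<close> partition the paths, so the total splits by O-D
    pair, and the demand constraint fixes each part at \<open>Q w\<close> divided by the step
    length.\<close>
  also have "\<dots> = (\<Sum>p\<in>(\<Union>w\<in>W. P w). \<Sum>k\<in>UNIV. h $ k $ p)"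
    unfolding assms(4) by (rule sum.swap)
  also have "\<dots> = (\<Sum>w\<in>W. \<Sum>p\<in>P w. \<Sum>k\<in>UNIV. h $ k $ p)"
    using assms(2,3) by (intro sum.UNION_disjoint) (auto simp: disjoint_family_on_def)
  also have "\<dots> = (\<Sum>w\<in>W. Q w * real CARD('n) / (tf - t0))"
    using h assms(1) by (intro sum.cong) (auto simp: discrete_flows_def field_simps)
  finally show "norm h \<le> (\<Sum>w\<in>W. Q w * real CARD('n) / (tf - t0))" .
qed

lemma od_pair_eq:
  assumes "disjoint_family_on P W" "w \<in> W" "p \<in> P w"
  shows "od_pair W P p = w"
  unfolding od_pair_def using assms by (intro the_equality) (auto simp: disjoint_family_on_def)

text \<open>The last summand is shared by all paths of \<open>w\<close> and cancels when two entries
  of one pair are compared. What remains is the maximum of the minimal delay and the delay reduced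
  by the path's tolerance.\<close>

lemma Phi_bar_nth:
  fixes h :: "real ^ 'p::finite ^ 'n::{finite,linorder}"
  assumes "disjoint_family_on P W" "w \<in> W" "p \<in> P w"
  shows "Phi_bar t0 tf W P Psi eps h $ k $ p =
    max (delay_avg t0 tf Psi k p h) (min_delay t0 tf P Psi w h + tolerance t0 tf eps w p h)
    - tolerance t0 tf eps w p h + Min ((\<lambda>q. tolerance t0 tf eps w q h) ` P w)"
  by (simp add: Phi_bar_def od_pair_eq[OF assms])

lemma min_delay_le:
  fixes h :: "real ^ 'p::finite ^ 'n::{finite,linorder}"
  assumes "p \<in> P w"
  shows "min_delay t0 tf P Psi w h \<le> delay_avg t0 tf Psi k p h"
  unfolding min_delay_def by (rule Min_le) (use assms in force)+

lemma min_delay_attained: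
  fixes h :: "real ^ 'p::finite ^ 'n::{finite,linorder}"
  assumes "P w \<noteq> {}"
  obtains k p where "p \<in> P w" "delay_avg t0 tf Psi k p h = min_delay t0 tf P Psi w h"
proof -
  have "min_delay t0 tf P Psi w h \<in> (\<lambda>(k, p). delay_avg t0 tf Psi k p h) ` (UNIV \<times> P w)"
    unfolding min_delay_def by (rule Min_in) (use assms in auto)
  then show thesis using that by auto
qed

lemma Phi_bar_minimal_iff:
  fixes h :: "real ^ 'p::finite ^ 'n::{finite,linorder}"
  assumes "disjoint_family_on P W" "w \<in> W" "p \<in> P w"
    and tol: "\<And>q. q \<in> P w \<Longrightarrow> 0 \<le> tolerance t0 tf eps w q h"
  shows "(\<forall>l. \<forall>q\<in>P w. Phi_bar t0 tf W P Psi eps h $ k $ p \<le> Phi_bar t0 tf W P Psi eps h $ l $ q)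
    \<longleftrightarrow> delay_avg t0 tf Psi k p h \<le> min_delay t0 tf P Psi w h + tolerance t0 tf eps w p h"
    (is "?minimal \<longleftrightarrow> ?tolerated")
proof
  note Phi = Phi_bar_nth[OF assms(1,2)]
  show ?minimal if ?tolerated
    using that by (auto simp: Phi assms(3))
  show ?tolerated if ?minimal
  proof -
    \<comment> \<open>At a minimizer of the delay, the nonnegative tolerance makes the second
      argument of the maximum win, so this entry attains the lower bound.\<close>
    obtain l q where q: "q \<in> P w" "delay_avg t0 tf Psi l q h = min_delay t0 tf P Psi w h"
      using min_delay_attained assms(3) by (metis empty_iff)
    then have "Phi_bar t0 tf W P Psi eps h $ k $ p \<le> Phi_bar t0 tf W P Psi eps h $ l $ q"
      using that by blast
    then show ?thesis
      using tol[OF q(1)] by (simp add: Phi assms(3) q)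
  qed
qed

text \<open>The premise of positive flow is an open condition, so the defining implication is not
  visibly closed; multiplying by the nonnegative flow encodes it as a weak inequality. Each
  inequality is confined to \<open>discrete_flows\<close>, where continuity of
  \<open>Phi_bar\<close> will be available, and the outer intersection handles an empty index
  family.\<close>

lemma discrete_vt_br_due_eq:
  fixes P :: "'w \<Rightarrow> 'p::finite set"
  assumes "disjoint_family_on P W"
    and tol: "\<And>(h :: real ^ 'p ^ 'n::{finite,linorder}) w q. h \<in> discrete_flows t0 tf W P Q
      \<Longrightarrow> w \<in> W \<Longrightarrow> q \<in> P w \<Longrightarrow> 0 \<le> tolerance t0 tf eps w q h"
  shows "(discrete_vt_br_due t0 tf W P Q Psi eps :: (real ^ 'p ^ 'n::_) set) =
    discrete_flows t0 tf W P Q \<inter>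
    (\<Inter>w\<in>W. \<Inter>p\<in>P w. \<Inter>q\<in>P w. \<Inter>k. \<Inter>l. {h \<in> discrete_flows t0 tf W P Q.
      h $ k $ p * (Phi_bar t0 tf W P Psi eps h $ k $ p - Phi_bar t0 tf W P Psi eps h $ l $ q) \<le> 0})"
    (is "_ = ?F \<inter> ?C")
proof (rule set_eqI)
  fix h :: "real ^ 'p ^ 'n::_"
  let ?Phi = "Phi_bar t0 tf W P Psi eps h"
  show "h \<in> discrete_vt_br_due t0 tf W P Q Psi eps \<longleftrightarrow> h \<in> ?F \<inter> ?C"
  proof (cases "h \<in> ?F")
    case True
    have sign: "h $ k $ p * (?Phi $ k $ p - ?Phi $ l $ q) \<le> 0
        \<longleftrightarrow> (0 < h $ k $ p \<longrightarrow> ?Phi $ k $ p \<le> ?Phi $ l $ q)" for k l p q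
    proof -
      have "0 \<le> h $ k $ p" using True by (simp add: discrete_flows_def)
      then show ?thesis by (auto simp: mult_le_0_iff)
    qed
    have "h \<in> ?C \<longleftrightarrow> (\<forall>w\<in>W. \<forall>p\<in>P w. \<forall>k. 0 < h $ k $ p \<longrightarrow>
        (\<forall>l. \<forall>q\<in>P w. ?Phi $ k $ p \<le> ?Phi $ l $ q))"
      using True by (simp add: sign) blast
    also have "\<dots> \<longleftrightarrow> (\<forall>w\<in>W. \<forall>p\<in>P w. \<forall>k. 0 < h $ k $ p \<longrightarrow>
        delay_avg t0 tf Psi k p h \<le> min_delay t0 tf P Psi w h + tolerance t0 tf eps w p h)"
      by (simp add: Phi_bar_minimal_iff[OF assms(1)] tol[OF True] cong: ball_cong)
    \<comment> \<open>The lower end of the tolerance interval is automatic, so only the upper end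
      has to be matched.\<close>
    finally show ?thesis
      using True by (simp add: discrete_vt_br_due_def min_delay_le cong: ball_cong)
  qed (simp add: discrete_vt_br_due_def)
qed

text \<open>Continuity on \<open>discrete_flows\<close> alone gives relative closedness of each
  inequality; as that set is closed, this is closedness in the whole space.\<close>

lemma closed_discrete_vt_br_due:
  fixes P :: "'w \<Rightarrow> 'p::finite set"
  assumes "disjoint_family_on P W"
    and "\<And>(h :: real ^ 'p ^ 'n::{finite,linorder}) w q. h \<in> discrete_flows t0 tf W P Q
      \<Longrightarrow> w \<in> W \<Longrightarrow> q \<in> P w \<Longrightarrow> 0 \<le> tolerance t0 tf eps w q h"
    and "continuous_on (discrete_flows t0 tf W P Q :: (real ^ 'p ^ 'n::_) set)
      (Phi_bar t0 tf W P Psi eps)"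
  shows "closed (discrete_vt_br_due t0 tf W P Q Psi eps :: (real ^ 'p ^ 'n::_) set)"
  by (subst discrete_vt_br_due_eq[OF assms(1,2)], assumption+,
      intro closed_Int closed_INT ballI closed_discrete_flows, rule continuous_on_closed_Collect_le)
    (intro continuous_intros assms(3) closed_discrete_flows)+

theorem proposition6p4:
  fixes t0 tf :: real
    and W :: "('v \<times> 'v) set"
    and P :: "'v \<times> 'v \<Rightarrow> 'p::finite set"
    and Q :: "'v \<times> 'v \<Rightarrow> real"
    and Psi :: "'p flow \<Rightarrow> 'p flow"
    and eps :: "'v \<times> 'v \<Rightarrow> 'p \<Rightarrow> 'p flow \<Rightarrow> real"
  assumes "t0 < tf"
    and "finite W"
    and "\<forall>w\<in>W. P w \<noteq> {}"
    and "disjoint_family_on P W"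
    and "(\<Union>w\<in>W. P w) = UNIV"
    and "\<forall>w\<in>W. 0 < Q w"
    and "\<forall>h\<in>feasible_flows t0 tf W P Q. \<forall>p. Psi h p \<in> L2_nonneg t0 tf \<and>
           (AE t in lebesgue_on {t0..tf}. 0 < Psi h p t)"
    and "\<forall>h\<in>feasible_flows t0 tf W P Q. \<forall>w\<in>W. \<forall>p\<in>P w. 0 < eps w p h"
    and "\<forall>g\<in>feasible_flows t0 tf W P Q. \<forall>h\<in>feasible_flows t0 tf W P Q. flow_eq t0 tf g h \<longrightarrow>
           flow_eq t0 tf (Psi g) (Psi h) \<and> (\<forall>w\<in>W. \<forall>p\<in>P w. eps w p g = eps w p h)"
    and "continuous_on (discrete_flows t0 tf W P Q :: (real ^ 'p ^ 'n::{finite,linorder}) set)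
           (Phi_bar t0 tf W P Psi eps)"
  shows "(discrete_vt_br_due t0 tf W P Q Psi eps :: (real ^ 'p ^ 'n::_) set)
           \<subseteq> discrete_flows t0 tf W P Q \<and>
         closed (discrete_vt_br_due t0 tf W P Q Psi eps :: (real ^ 'p ^ 'n::_) set) \<and>
         bounded (discrete_vt_br_due t0 tf W P Q Psi eps :: (real ^ 'p ^ 'n::_) set) \<and>
         compact (discrete_vt_br_due t0 tf W P Q Psi eps :: (real ^ 'p ^ 'n::_) set)"
proof (intro conjI)
  let ?S = "discrete_vt_br_due t0 tf W P Q Psi eps :: (real ^ 'p ^ 'n::_) set"
  show sub: "?S \<subseteq> discrete_flows t0 tf W P Q"
    by (auto simp: discrete_vt_br_due_def)
  \<comment> \<open>Positivity of \<open>eps\<close> is assumed on feasible flows only;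
    \<open>step_flow_pc\<close> makes the step function of \<open>h\<close> one of them.\<close>
  have tol: "0 \<le> tolerance t0 tf eps w q h"
    if "h \<in> discrete_flows t0 tf W P Q" "w \<in> W" "q \<in> P w" for h :: "real ^ 'p ^ 'n::_" and w q
    using step_flow_pc[OF assms(1) that(1)] that(2,3) assms(8)
    by (auto simp: tolerance_def pc_flows_def intro!: less_imp_le)
  show cl: "closed ?S"
    using closed_discrete_vt_br_due[OF assms(4) tol assms(10)] .
  show bd: "bounded ?S"
    using bounded_discrete_flows[OF assms(1,2,4,5)] sub by (rule bounded_subset)
  show "compact ?S"
    using cl bd by (simp add: compact_eq_bounded_closed)
qed

end
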